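(* Let $0<X<\infty$, let $q_0,q_1,q_2$ be real polynomials $q_0(x)=\sum_{l=0}^{r_0}A_lx^l$, $q_1(x)=\sum_{l=0}^{r_1}B_lx^l$, $q_2(x)=\sum_{l=0}^{r_2}C_lx^l$ with integers $r_0,r_1,r_2\ge1$, and let $r=\max\{r_0,r_1,r_2\}$ and $M(j)=j(r+1)$. For $n=1,2,\dots$ let $u_n^{(j)}$, $j=0,1,\dots$, be the eigenfunction corrections of the FD-method defined in the context. Then for every $n=1,2,\dots$ and every $j=0,1,\dots$ there are real coefficients $a_{n,p}^{(j+1)},b_{n,p}^{(j+1)}$ ($0\le p\le M(j+1)$) and $c_{n,p}^{(j+1)},d_{n,p}^{(j+1)}$ ($0\le p\le M(j)$) such that, for all $x\in[0,X]$, $$u_n^{(j+1)}(x)=\sum_{p=0}^{M(j+1)}x^p\left[b_{n,p}^{(j+1)}\cos\left(\frac{\pi n}{X}x\right)+a_{n,p}^{(j+1)}\sin\left(\frac{\pi n}{X}x\right)\right]+\sum_{p=0}^{M(j)}x^p\left[d_{n,p}^{(j+1)}\cosh\left(\frac{\pi n}{X}x\right)+c_{n,p}^{(j+1)}\sinh\left(\frac{\pi n}{X}x\right)\right],$$ where the initial coefficients (those of $u_n^{(0)}$) are $a_{n,0}^{(0)}=\sqrt{2/X}$ and $b_{n,0}^{(0)}=c_{n,0}^{(0)}=d_{n,0}^{(0)}=0$.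
   Context: FD-method (simplest variant) for the eigenvalue problem $u^{\rm IV}+q_2u''+q_1u'+(q_0-\lambda)u=0$ on $(0,X)$, $u(0)=u''(0)=u(X)=u''(X)=0$. For each $n=1,2,\dots$ the corrections $\lambda_n^{(j)}\in\mathbb{R}$ and $u_n^{(j)}:[0,X]\to\mathbb{R}$, $j=0,1,2,\dots$, are defined recursively. The initial terms are $$u_n^{(0)}(x)=\sqrt{\tfrac{2}{X}}\,\sin\left(\tfrac{n\pi}{X}x\right),\qquad \lambda_n^{(0)}=\frac{(n\pi)^4}{X^4}.$$ Given $u_n^{(0)},\dots,u_n^{(j)}$ and $\lambda_n^{(0)},\dots,\lambda_n^{(j)}$, put $$\lambda_n^{(j+1)}=\int_0^X\left(q_2(x)\frac{d^2u_n^{(j)}(x)}{dx^2}+q_1(x)\frac{du_n^{(j)}(x)}{dx}+q_0(x)u_n^{(j)}(x)\right)u_n^{(0)}(x)\,dx,$$ and let $u_n^{(j+1)}$ be the solution of $$\frac{d^4}{dx^4}u_n^{(j+1)}(x)-\lambda_n^{(0)}u_n^{(j+1)}(x)=F_n^{(j+1)}(x),\quad x\in(0,X),$$ $$u_n^{(j+1)}(0)=\frac{d^2u_n^{(j+1)}}{dx^2}(0)=u_n^{(j+1)}(X)=\frac{d^2u_n^{(j+1)}}{dx^2}(X)=0,\qquad \int_0^Xu_n^{(j+1)}(x)u_n^{(0)}(x)\,dx=0,$$ where $$F_n^{(j+1)}(x)=\sum_{p=0}^{j}\lambda_n^{(j+1-p)}u_n^{(p)}(x)-q_2(x)\frac{d^2}{dx^2}u_n^{(j)}(x)-q_1(x)\frac{d}{dx}u_n^{(j)}(x)-q_0(x)u_n^{(j)}(x).$$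 (The choice of $\lambda_n^{(j+1)}$ is the solvability condition $\int_0^XF_n^{(j+1)}u_n^{(0)}dx=0$.) *)

theory Defs
  imports "HOL-Analysis.Analysis"
begin

(* Derivative relative to [0,X]: one-sided at the end points, the usual derivative inside.
   It depends only on the values of f on [0,X]. *)
definition ivl_deriv :: "real \<Rightarrow> (real \<Rightarrow> real) \<Rightarrow> real \<Rightarrow> real" where
  "ivl_deriv X f x = vector_derivative f (at x within {0..X})"

definition fd_pert ::
  "real \<Rightarrow> (real \<Rightarrow> real) \<Rightarrow> (real \<Rightarrow> real) \<Rightarrow> (real \<Rightarrow> real) \<Rightarrow> (real \<Rightarrow> real) \<Rightarrow> real \<Rightarrow> real" where
  "fd_pert X q0 q1 q2 v x =
     q2 x * (ivl_deriv X ^^ 2) v x + q1 x * ivl_deriv X v x + q0 x * v x"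

(* v is a classical solution of v'''' - mu v = F on (0,X) with v = v'' = 0 at both end points,
   orthogonal to phi.  The differentiability conditions are exactly those needed for the
   equation and the boundary conditions to make sense. *)
definition fd_solution ::
  "real \<Rightarrow> real \<Rightarrow> (real \<Rightarrow> real) \<Rightarrow> (real \<Rightarrow> real) \<Rightarrow> (real \<Rightarrow> real) \<Rightarrow> bool" where
  "fd_solution X \<mu> \<phi> F v \<longleftrightarrow>
     (\<forall>k<2. (ivl_deriv X ^^ k) v differentiable_on {0..X}) \<and>
     (\<forall>k<4. (ivl_deriv X ^^ k) v differentiable_on {0<..<X}) \<and>
     (\<forall>x\<in>{0<..<X}. (ivl_deriv X ^^ 4) v x - \<mu> * v x = F x) \<and>
     v 0 = 0 \<and> (ivl_deriv X ^^ 2) v 0 = 0 \<and> v X = 0 \<and> (ivl_deriv X ^^ 2) v X = 0 \<and>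
     integral {0..X} (\<lambda>x. v x * \<phi> x) = 0"

(* The corrections lambda_n^(j) and u_n^(j).  The solution of the boundary value problem is
   unique as a function on [0,X]; SOME only leaves its values outside [0,X] unspecified, and
   these enter neither fd_pert on [0,X] nor the integrals. *)
function fd_lambda ::
    "real \<Rightarrow> (real \<Rightarrow> real) \<Rightarrow> (real \<Rightarrow> real) \<Rightarrow> (real \<Rightarrow> real) \<Rightarrow> nat \<Rightarrow> nat \<Rightarrow> real"
  and fd_u ::
    "real \<Rightarrow> (real \<Rightarrow> real) \<Rightarrow> (real \<Rightarrow> real) \<Rightarrow> (real \<Rightarrow> real) \<Rightarrow> nat \<Rightarrow> nat \<Rightarrow> real \<Rightarrow> real"
where
  "fd_lambda X q0 q1 q2 n 0 = (real n * pi) ^ 4 / X ^ 4"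
| "fd_lambda X q0 q1 q2 n (Suc j) =
     integral {0..X} (\<lambda>x. fd_pert X q0 q1 q2 (fd_u X q0 q1 q2 n j) x * fd_u X q0 q1 q2 n 0 x)"
| "fd_u X q0 q1 q2 n 0 = (\<lambda>x. sqrt (2 / X) * sin (real n * pi / X * x))"
| "fd_u X q0 q1 q2 n (Suc j) =
     (SOME v. fd_solution X (fd_lambda X q0 q1 q2 n 0) (fd_u X q0 q1 q2 n 0)
        (\<lambda>x. (\<Sum>p\<in>{0..j}. fd_lambda X q0 q1 q2 n (j + 1 - p) * fd_u X q0 q1 q2 n p x)
              - fd_pert X q0 q1 q2 (fd_u X q0 q1 q2 n j) x) v)"
  by pat_completeness auto
termination
  by (relation "Wellfounded.measure (\<lambda>s. case s of Inl (_, _, _, _, _, j) \<Rightarrow> 2 * j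
                                     | Inr (_, _, _, _, _, j) \<Rightarrow> 2 * j + 1)") auto

end

theory Submission
  imports Defs
begin

text \<open>Write \<open>k = \<pi> n / X\<close>. Functions \<open>b cos kx + a sin kx + d cosh kx + c sinh kx\<close> with polynomial
  coefficients are closed under differentiation and multiplication by polynomials, and
  \<open>D\<^sup>4 - k\<^sup>4\<close> is onto on them; because of resonance, inverting it raises both the trigonometric and
  the hyperbolic degree bound by one. The perturbation raises degrees by at most \<open>r\<close>, so each step of
  the recursion costs \<open>r + 1\<close>; the hyperbolic terms lag one step behind, as they enter only through
  the homogeneous solution added for the boundary conditions at the first step. Any classical solution
  differs from a particular one by a homogeneous solution on the open interval, hence by continuity on
  the closed one. For existence, three boundary conditions are met by choice of the homogeneous
  part, and Green's identity against \<open>sin kx\<close> turns the orthogonality of the right-hand side into the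
  fourth.\<close>

section \<open>Polynomials of bounded degree and linear differential systems over them\<close>

text \<open>The bound is strict, so that \<open>m = 0\<close> means the zero polynomial. This gives
  the inductions on \<open>m\<close> a trivial base and lets a degree bound of 0 express that a
  component is absent.\<close>

definition polys_below :: "nat \<Rightarrow> real poly set" where
  "polys_below m = {p. \<forall>i\<ge>m. coeff p i = 0}"

lemma polys_below_0 [simp]: "polys_below 0 = {0}"
  by (auto simp: polys_below_def poly_eq_iff)

lemma polys_below_mono: "m \<le> m' \<Longrightarrow> polys_below m \<subseteq> polys_below m'"
  by (auto simp: polys_below_def)

lemma zero_in_polys_below [simp]: "0 \<in> polys_below m"
  by (simp add: polys_below_def)

lemma const_in_polys_below: "[:c:] \<in> polys_below (Suc m)"
  by (auto simp: polys_below_def coeff_pCons split: nat.split)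

lemma polys_below_add: "p \<in> polys_below m \<Longrightarrow> q \<in> polys_below m \<Longrightarrow> p + q \<in> polys_below m"
  by (simp add: polys_below_def)

lemma polys_below_smult: "p \<in> polys_below m \<Longrightarrow> smult c p \<in> polys_below m"
  by (simp add: polys_below_def)

lemma polys_below_pderiv_Suc: "p \<in> polys_below (Suc m) \<Longrightarrow> pderiv p \<in> polys_below m"
  by (simp add: polys_below_def coeff_pderiv)

lemma polys_below_pderiv: "p \<in> polys_below m \<Longrightarrow> pderiv p \<in> polys_below m"
  by (simp add: polys_below_def coeff_pderiv)

lemma polys_below_mult:
  assumes "p \<in> polys_below m" "q \<in> polys_below (Suc r)"
  shows "q * p \<in> polys_below (m + r)"
proof -
  have "coeff (q * p) i = 0" if "m + r \<le> i" for i
    unfolding coeff_mult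
  proof (rule sum.neutral, safe)
    fix j assume "j \<le> i"
    show "coeff q j * coeff p (i - j) = 0"
      \<comment> \<open>If \<open>j \<le> r\<close>, then \<open>i - j \<ge> m\<close> and the
        second factor vanishes; otherwise the first one does.\<close>
      using assms that by (cases "j \<le> r") (auto simp: polys_below_def)
  qed
  then show ?thesis by (simp add: polys_below_def)
qed

lemma polys_below_antideriv:
  assumes "p \<in> polys_below m"
  obtains q where "q \<in> polys_below (Suc m)" "pderiv q = p"
proof
  define q where "q = (\<Sum>i<m. monom (coeff p i / real (Suc i)) (Suc i))"
  have c: "coeff q j = (if 0 < j \<and> j \<le> m then coeff p (j - 1) / real j else 0)" for j
  proof -
    have "coeff q j = (\<Sum>i<m. if i = j - 1 \<and> 0 < j then coeff p (j - 1) / real j else 0)"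
      unfolding q_def coeff_sum by (intro sum.cong) (auto simp: coeff_monom)
    also have "\<dots> = (if 0 < j \<and> j \<le> m then coeff p (j - 1) / real j else 0)"
      by (cases "0 < j") auto
    finally show ?thesis .
  qed
  show "q \<in> polys_below (Suc m)"
    by (auto simp: polys_below_def c)
  show "pderiv q = p"
    using assms by (intro poly_eqI) (auto simp: coeff_pderiv c polys_below_def)
qed

lemma sum_power_eq_poly:
  fixes A :: "nat \<Rightarrow> real"
  assumes "s \<le> r"
  obtains p where "p \<in> polys_below (Suc r)" "(\<lambda>x. \<Sum>l=0..s. A l * x ^ l) = poly p"
proof
  let ?p = "\<Sum>l=0..s. monom (A l) l"
  show "?p \<in> polys_below (Suc r)"
    using assms by (auto simp: polys_below_def coeff_sum coeff_monom intro!: sum.neutral)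
  show "(\<lambda>x. \<Sum>l=0..s. A l * x ^ l) = poly ?p"
    by (simp add: fun_eq_iff poly_sum poly_monom)
qed

lemma poly_eq_sum_below:
  assumes "p \<in> polys_below (Suc m)"
  shows "poly p x = (\<Sum>i=0..m. coeff p i * x ^ i)"
proof -
  have "degree p \<le> m"
    using assms by (intro degree_le) (simp add: polys_below_def)
  then show ?thesis
    using poly_as_sum_of_monoms'[of p m]
    by (metis (no_types, lifting) atLeast0AtMost poly_monom poly_sum sum.cong)
qed

text \<open>Solvable since the derivative terms lower the degree, so that the right-hand side divided by
  the constant coefficients is a solution up to an error of smaller degree.\<close>

lemma first_order_system_solvable:
  fixes c c' :: real
  assumes "c \<noteq> 0" "c' \<noteq> 0" "f \<in> polys_below m" "g \<in> polys_below m"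
  shows "\<exists>p\<in>polys_below m. \<exists>q\<in>polys_below m.
    pderiv p + smult c q = f \<and> pderiv q + smult c' p = g"
  using assms(3,4)
proof (induction m arbitrary: f g)
  case 0
  then show ?case by simp
next
  case (Suc m)
  define p where "p = smult (1/c') g"
  define q where "q = smult (1/c) f"
  have pq: "p \<in> polys_below (Suc m)" "q \<in> polys_below (Suc m)"
    unfolding p_def q_def using Suc.prems polys_below_smult by blast+
  have "smult (-1) (pderiv p) \<in> polys_below m" "smult (-1) (pderiv q) \<in> polys_below m"
    using pq polys_below_pderiv_Suc polys_below_smult by blast+
  from Suc.IH[OF this] obtain p1 q1 where 1: "p1 \<in> polys_below m" "q1 \<in> polys_below m"
    "pderiv p1 + smult c q1 = smult (-1) (pderiv p)"
    "pderiv q1 + smult c' p1 = smult (-1) (pderiv q)" by blast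
  have 2: "smult c q = f" "smult c' p = g"
    using assms by (simp_all add: p_def q_def)
  have "p + p1 \<in> polys_below (Suc m)" "q + q1 \<in> polys_below (Suc m)"
    using pq 1 polys_below_mono[of m "Suc m"] by (auto intro!: polys_below_add)
  moreover have "pderiv (p + p1) + smult c (q + q1) = f"
    "pderiv (q + q1) + smult c' (p + p1) = g"
    using 1(3,4) 2 by (simp_all add: pderiv_add smult_add_right algebra_simps)
  ultimately show ?case by blast
qed

text \<open>The same correction by induction on the degree as for first-order systems: every
  derivative term lowers the degree, whatever \<open>s\<close> and \<open>t\<close> are, and only
  the zeroth-order coefficient \<open>c\<close> has to be inverted.\<close>

lemma second_order_system_solvable:
  fixes c s t :: real
  assumes "c \<noteq> 0" "f \<in> polys_below m" "g \<in> polys_below m"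
  shows "\<exists>p\<in>polys_below m. \<exists>q\<in>polys_below m.
    pderiv (pderiv p) + smult s (pderiv q) + smult c p = f \<and>
    pderiv (pderiv q) + smult t (pderiv p) + smult c q = g"
  using assms(2,3)
proof (induction m arbitrary: f g)
  case 0
  then show ?case by simp
next
  case (Suc m)
  define p where "p = smult (1/c) f"
  define q where "q = smult (1/c) g"
  have pq: "p \<in> polys_below (Suc m)" "q \<in> polys_below (Suc m)"
    unfolding p_def q_def using Suc.prems polys_below_smult by blast+
  have "smult (-1) (pderiv (pderiv p) + smult s (pderiv q)) \<in> polys_below m"
    "smult (-1) (pderiv (pderiv q) + smult t (pderiv p)) \<in> polys_below m"
    using pq by (blast intro: polys_below_smult polys_below_add polys_below_pderiv polys_below_pderiv_Suc)+
  from Suc.IH[OF this] obtain p1 q1 where 1: "p1 \<in> polys_below m" "q1 \<in> polys_below m"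
    "pderiv (pderiv p1) + smult s (pderiv q1) + smult c p1
       = smult (-1) (pderiv (pderiv p) + smult s (pderiv q))"
    "pderiv (pderiv q1) + smult t (pderiv p1) + smult c q1
       = smult (-1) (pderiv (pderiv q) + smult t (pderiv p))" by blast
  have 2: "smult c p = f" "smult c q = g"
    using assms by (simp_all add: p_def q_def)
  have "p + p1 \<in> polys_below (Suc m)" "q + q1 \<in> polys_below (Suc m)"
    using pq 1 polys_below_mono[of m "Suc m"] by (auto intro!: polys_below_add)
  moreover have "pderiv (pderiv (p + p1)) + smult s (pderiv (q + q1)) + smult c (p + p1) = f"
    "pderiv (pderiv (q + q1)) + smult t (pderiv (p + p1)) + smult c (q + q1) = g"
    using 1(3,4) 2 by (simp_all add: pderiv_add smult_add_right algebra_simps)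
  ultimately show ?case by blast
qed

section \<open>Smooth functions\<close>

definition smooth :: "(real \<Rightarrow> real) \<Rightarrow> bool" where
  "smooth f \<longleftrightarrow> (\<forall>i x. ((deriv ^^ i) f has_real_derivative (deriv ^^ Suc i) f x) (at x))"

lemma smooth_has_deriv:
  "smooth f \<Longrightarrow> ((deriv ^^ i) f has_real_derivative (deriv ^^ Suc i) f x) (at x)"
  unfolding smooth_def by blast

lemma smooth_deriv_iter_lincomb:
  assumes "smooth f" "smooth g"
  shows "(deriv ^^ i) (\<lambda>x. a * f x + b * g x) = (\<lambda>x. a * (deriv ^^ i) f x + b * (deriv ^^ i) g x)"
proof (induction i)
  case (Suc i)
  have "(deriv ^^ Suc i) (\<lambda>x. a * f x + b * g x) =
      deriv (\<lambda>x. a * (deriv ^^ i) f x + b * (deriv ^^ i) g x)"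
    using Suc by simp
  also have "\<dots> = (\<lambda>x. a * (deriv ^^ Suc i) f x + b * (deriv ^^ Suc i) g x)"
    by (intro ext DERIV_imp_deriv DERIV_add DERIV_cmult smooth_has_deriv assms)
  finally show ?case .
qed simp

lemma smooth_lincomb:
  assumes "smooth f" "smooth g"
  shows "smooth (\<lambda>x. a * f x + b * g x)"
  unfolding smooth_def smooth_deriv_iter_lincomb[OF assms]
  by (intro allI DERIV_add DERIV_cmult smooth_has_deriv assms)

section \<open>Trigonometric and hyperbolic quasi-polynomials\<close>

text \<open>Treats both function pairs at once: \<open>e = -1\<close> is cosine and sine,
  \<open>e = 1\<close> is hyperbolic cosine and sine. \<open>C\<close> and \<open>S\<close> span the
  solutions of \<open>y'' = e k^2 y\<close>, and \<open>CS\<close> is the Pythagorean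
  identity.\<close>

locale oscillator =
  fixes k e :: real and C S :: "real \<Rightarrow> real"
  assumes k: "k \<noteq> 0" and e: "e * e = 1"
    and dC: "\<And>x. (C has_real_derivative e * k * S x) (at x)"
    and dS: "\<And>x. (S has_real_derivative k * C x) (at x)"
    and CS: "\<And>x. C x * C x - e * (S x * S x) = 1"
begin

definition quasi :: "nat \<Rightarrow> (real \<Rightarrow> real) set" where
  "quasi m = {f. \<exists>b\<in>polys_below m. \<exists>a\<in>polys_below m. f = (\<lambda>x. poly b x * C x + poly a x * S x)}"

lemma quasiI:
  "b \<in> polys_below m \<Longrightarrow> a \<in> polys_below m \<Longrightarrow> (\<lambda>x. poly b x * C x + poly a x * S x) \<in> quasi m"
  unfolding quasi_def by blast

lemma quasiE:
  assumes "f \<in> quasi m"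
  obtains b a where "b \<in> polys_below m" "a \<in> polys_below m"
    "f = (\<lambda>x. poly b x * C x + poly a x * S x)"
  using assms unfolding quasi_def by blast

lemma has_deriv_form:
  "((\<lambda>x. poly b x * C x + poly a x * S x) has_real_derivative
    (poly (pderiv b + smult k a) x * C x + poly (pderiv a + smult (e * k) b) x * S x)) (at x)"
  by (rule derivative_eq_intros poly_DERIV dC dS refl)+ (simp add: algebra_simps)

lemma deriv_form:
  "deriv (\<lambda>x. poly b x * C x + poly a x * S x) =
    (\<lambda>x. poly (pderiv b + smult k a) x * C x + poly (pderiv a + smult (e * k) b) x * S x)"
  using has_deriv_form DERIV_imp_deriv by blast

lemma quasi_deriv: "f \<in> quasi m \<Longrightarrow> deriv f \<in> quasi m"
  by (elim quasiE) (simp only: deriv_form, intro quasiI polys_below_add polys_below_smult polys_below_pderiv)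

lemma quasi_deriv_iter: "f \<in> quasi m \<Longrightarrow> (deriv ^^ i) f \<in> quasi m"
  by (induction i) (auto intro: quasi_deriv)

lemma quasi_smooth: "f \<in> quasi m \<Longrightarrow> smooth f"
proof -
  assume f: "f \<in> quasi m"
  have "(g has_real_derivative deriv g x) (at x)" if "g \<in> quasi m" for g x
    using that by (elim quasiE) (simp only: deriv_form has_deriv_form)
  with quasi_deriv_iter[OF f] show "smooth f" by (simp add: smooth_def)
qed

lemma quasi_lincomb:
  assumes "f \<in> quasi m" "g \<in> quasi m"
  shows "(\<lambda>x. s * f x + t * g x) \<in> quasi m"
proof -
  obtain b a b' a' where *: "b \<in> polys_below m" "a \<in> polys_below m"
    "f = (\<lambda>x. poly b x * C x + poly a x * S x)" "b' \<in> polys_below m" "a' \<in> polys_below m"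
    "g = (\<lambda>x. poly b' x * C x + poly a' x * S x)"
    using assms by (elim quasiE)
  then have "(\<lambda>x. s * f x + t * g x) =
    (\<lambda>x. poly (smult s b + smult t b') x * C x + poly (smult s a + smult t a') x * S x)"
    by (simp add: algebra_simps)
  then show ?thesis
    using * by (simp only: quasiI polys_below_add polys_below_smult)
qed

lemma quasi_mult:
  assumes "f \<in> quasi m" "p \<in> polys_below (Suc r)"
  shows "(\<lambda>x. poly p x * f x) \<in> quasi (m + r)"
proof -
  obtain b a where *: "b \<in> polys_below m" "a \<in> polys_below m"
    "f = (\<lambda>x. poly b x * C x + poly a x * S x)"
    using assms by (elim quasiE)
  then have "(\<lambda>x. poly p x * f x) = (\<lambda>x. poly (p * b) x * C x + poly (p * a) x * S x)"
    by (simp add: algebra_simps)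
  then show ?thesis
    using * assms by (simp only: quasiI polys_below_mult)
qed

lemma quasi_mono: "m \<le> m' \<Longrightarrow> quasi m \<subseteq> quasi m'"
  using polys_below_mono unfolding quasi_def by blast

lemma quasi_0: "quasi 0 = {\<lambda>x. 0}"
  by (auto simp: quasi_def)

lemma deriv2_form:
  "deriv (deriv (\<lambda>x. poly b x * C x + poly a x * S x)) =
    (\<lambda>x. poly (pderiv (pderiv b) + smult (2 * k) (pderiv a) + smult (e * k\<^sup>2) b) x * C x +
         poly (pderiv (pderiv a) + smult (2 * e * k) (pderiv b) + smult (e * k\<^sup>2) a) x * S x)"
  unfolding deriv_form
  by (simp add: pderiv_add pderiv_smult fun_eq_iff algebra_simps power2_eq_square)

text \<open>\<open>C\<close> and \<open>S\<close> lie in the kernel of the operator, so the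
  undifferentiated coefficients cancel. What remains is a first-order system for the derivatives of
  the coefficients of \<open>G\<close>; integrating its solution costs the extra degree.\<close>

lemma resonant_solvable:
  assumes "F \<in> quasi m"
  shows "\<exists>G\<in>quasi (Suc m). \<forall>x. deriv (deriv G) x = e * k\<^sup>2 * G x + F x"
proof -
  obtain f g where *: "f \<in> polys_below m" "g \<in> polys_below m"
    "F = (\<lambda>x. poly f x * C x + poly g x * S x)"
    using assms by (elim quasiE)
  have "e \<noteq> 0" using e by auto
  with k first_order_system_solvable[OF _ _ *(1,2), of "2 * k" "2 * e * k"]
  obtain p q where pq: "p \<in> polys_below m" "q \<in> polys_below m"
    "pderiv p + smult (2 * k) q = f" "pderiv q + smult (2 * e * k) p = g" by auto
  obtain b where b: "b \<in> polys_below (Suc m)" "pderiv b = p"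
    using pq polys_below_antideriv by blast
  obtain a where a: "a \<in> polys_below (Suc m)" "pderiv a = q"
    using pq polys_below_antideriv by blast
  show ?thesis
    by (rule bexI[OF _ quasiI[OF b(1) a(1)]])
       (unfold deriv2_form *(3) pq(3,4)[symmetric], simp add: a b algebra_simps)
qed

text \<open>With this sign the undifferentiated coefficients add up to the nonzero factor
  \<open>2 * e * k\<^sup>2\<close> instead of cancelling, so the coefficient system is solvable
  without raising the degree.\<close>

lemma nonresonant_solvable:
  assumes "F \<in> quasi m"
  shows "\<exists>G\<in>quasi m. \<forall>x. deriv (deriv G) x = - (e * k\<^sup>2 * G x) + F x"
proof -
  obtain f g where *: "f \<in> polys_below m" "g \<in> polys_below m"
    "F = (\<lambda>x. poly f x * C x + poly g x * S x)"
    using assms by (elim quasiE)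
  have "e \<noteq> 0" using e by auto
  with k second_order_system_solvable[OF _ *(1,2), of "2 * e * k\<^sup>2" "2 * k" "2 * e * k"]
  obtain b a where pq: "b \<in> polys_below m" "a \<in> polys_below m"
    "pderiv (pderiv b) + smult (2 * k) (pderiv a) + smult (2 * e * k\<^sup>2) b = f"
    "pderiv (pderiv a) + smult (2 * e * k) (pderiv b) + smult (2 * e * k\<^sup>2) a = g" by auto
  show ?thesis
    by (rule bexI[OF _ quasiI[OF pq(1,2)]])
       (unfold deriv2_form *(3) pq(3,4)[symmetric], simp add: algebra_simps)
qed

text \<open>The factorization \<open>D\<^sup>4 - k\<^sup>4 = (D\<^sup>2 - e k\<^sup>2) (D\<^sup>2 + e k\<^sup>2)\<close>; only the first factor annihilates
  \<open>C\<close> and \<open>S\<close> and costs a degree.\<close>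

lemma fourth_order_solvable:
  assumes "F \<in> quasi m"
  shows "\<exists>P\<in>quasi (Suc m). \<forall>x. (deriv ^^ 4) P x = k ^ 4 * P x + F x"
proof -
  obtain G where G: "G \<in> quasi (Suc m)" "\<And>x. deriv (deriv G) x = e * k\<^sup>2 * G x + F x"
    using resonant_solvable[OF assms] by blast
  obtain P where P: "P \<in> quasi (Suc m)" "\<And>x. deriv (deriv P) x = - (e * k\<^sup>2 * P x) + G x"
    using nonresonant_solvable[OF G(1)] by blast
  \<comment> \<open>The equation for \<open>P\<close> is differentiated twice and both second-order
    equations are substituted: the \<open>G\<close> terms cancel, and \<open>e * e = 1\<close>
    removes the sign from \<open>k ^ 4\<close>.\<close>
  have "(deriv ^^ 4) P = (deriv ^^ 2) (deriv (deriv P))"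
    by (simp add: eval_nat_numeral)
  also have "deriv (deriv P) = (\<lambda>x. (- (e * k\<^sup>2)) * P x + 1 * G x)"
    using P(2) by auto
  also have "(deriv ^^ 2) \<dots> = (\<lambda>x. (- (e * k\<^sup>2)) * (deriv ^^ 2) P x + 1 * (deriv ^^ 2) G x)"
    using quasi_smooth P(1) G(1) by (intro smooth_deriv_iter_lincomb) auto
  also have "\<dots> = (\<lambda>x. (- (e * k\<^sup>2)) * deriv (deriv P) x + 1 * deriv (deriv G) x)"
    by (simp add: eval_nat_numeral)
  also have "\<dots> = (\<lambda>x. (e * e) * k ^ 4 * P x + F x)"
    unfolding P(2) G(2) by (simp add: algebra_simps eval_nat_numeral)
  finally show ?thesis using e by (intro bexI[OF _ P(1)]) simp
qed

text \<open>The Wronskians of \<open>g\<close> with \<open>S\<close> and with \<open>C\<close> have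
  derivative zero, hence are constants \<open>A\<close> and \<open>B\<close> on the interval.
  Combining them with weights \<open>C\<close> and \<open>S\<close> yields \<open>k * g\<close> by
  the identity \<open>CS\<close>.\<close>

lemma homogeneous_solution:
  assumes I: "\<And>x. x \<in> {0<..<X} \<Longrightarrow> (g has_real_derivative g' x) (at x)"
    "\<And>x. x \<in> {0<..<X} \<Longrightarrow> (g' has_real_derivative e * k\<^sup>2 * g x) (at x)"
  shows "\<exists>A B. \<forall>x\<in>{0<..<X}. g x = A * C x + B * S x"
proof -
  have 1: "((\<lambda>x. k * g x * C x - g' x * S x) has_real_derivative 0) (at x)"
    if "x \<in> {0<..<X}" for x
    by (rule DERIV_cong[OF DERIV_diff[OF DERIV_mult[OF DERIV_cmult[OF I(1)[OF that]] dC]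
        DERIV_mult[OF I(2)[OF that] dS]]]) (simp add: algebra_simps power2_eq_square)
  have 2: "((\<lambda>x. g' x * C x - (e * k) * g x * S x) has_real_derivative 0) (at x)"
    if "x \<in> {0<..<X}" for x
    by (rule DERIV_cong[OF DERIV_diff[OF DERIV_mult[OF I(2)[OF that] dC]
        DERIV_mult[OF DERIV_cmult[OF I(1)[OF that]] dS]]]) (simp add: algebra_simps power2_eq_square)
  have const: "\<exists>c. \<forall>x\<in>{0<..<X}. h x = c"
    if "\<And>x. x \<in> {0<..<X} \<Longrightarrow> (h has_real_derivative 0) (at x)" for h :: "real \<Rightarrow> real"
    by (rule has_field_derivative_zero_constant[of "{0<..<X}" h])
       (simp_all add: has_field_derivative_at_within that)
  obtain A where A: "\<And>x. x \<in> {0<..<X} \<Longrightarrow> k * g x * C x - g' x * S x = A"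
    using const[OF 1] by blast
  obtain B where B: "\<And>x. x \<in> {0<..<X} \<Longrightarrow> g' x * C x - (e * k) * g x * S x = B"
    using const[OF 2] by blast
  have "g x = A / k * C x + B / k * S x" if "x \<in> {0<..<X}" for x
  proof -
    have "A * C x + B * S x = k * g x * (C x * C x - e * (S x * S x))"
      unfolding A[OF that, symmetric] B[OF that, symmetric] by (simp add: algebra_simps)
    then have "A * C x + B * S x = k * g x" by (simp add: CS)
    then show ?thesis using k by (simp add: field_simps)
  qed
  then show ?thesis by blast
qed

end

section \<open>Derivatives relative to the interval, and Green's identity\<close>

lemma smooth_continuous_on: "smooth f \<Longrightarrow> continuous_on A ((deriv ^^ i) f)"
  using smooth_has_deriv by (meson DERIV_continuous continuous_at_imp_continuous_on)

text \<open>\<open>ivl_deriv\<close> sees only values on \<open>{0..X}\<close>. A correction that is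
  unspecified elsewhere can therefore be replaced by a globally smooth representative
  \<open>w\<close> and differentiated with \<open>deriv\<close>.\<close>

lemma ivl_deriv_smooth:
  assumes "0 < X" "smooth w" "\<And>x. x \<in> {0..X} \<Longrightarrow> v x = w x" "x \<in> {0..X}"
  shows "(ivl_deriv X ^^ i) v x = (deriv ^^ i) w x"
  using assms(4)
proof (induction i arbitrary: x)
  case 0
  then show ?case using assms by simp
next
  case (Suc i)
  have "((deriv ^^ i) w has_vector_derivative (deriv ^^ Suc i) w x) (at x within {0..X})"
    using smooth_has_deriv[OF assms(2)]
    by (meson has_field_derivative_at_within has_real_derivative_iff_has_vector_derivative)
  then have "((ivl_deriv X ^^ i) v has_vector_derivative (deriv ^^ Suc i) w x) (at x within {0..X})"
    by (rule has_vector_derivative_transform[rotated 2]) (use Suc in auto)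
  then have "vector_derivative ((ivl_deriv X ^^ i) v) (at x within {0..X}) = (deriv ^^ Suc i) w x"
    using assms(1) Suc.prems by (intro vector_derivative_within_cbox[of 0 X, simplified]) auto
  then show ?case by (simp add: ivl_deriv_def[of X "(ivl_deriv X ^^ i) v"])
qed

lemma ivl_deriv_smooth_differentiable:
  assumes "0 < X" "smooth w" "\<And>x. x \<in> {0..X} \<Longrightarrow> v x = w x" "A \<subseteq> {0..X}"
  shows "(ivl_deriv X ^^ i) v differentiable_on A"
proof -
  have "(deriv ^^ i) w differentiable_on A"
    using smooth_has_deriv[OF assms(2)]
    by (meson differentiable_at_withinI differentiable_on_def real_differentiable_def)
  then show ?thesis
    unfolding differentiable_on_def
  proof (intro ballI)
    fix x assume x: "x \<in> A" and "\<forall>x\<in>A. (deriv ^^ i) w differentiable at x within A"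
    then have "(deriv ^^ i) w differentiable at x within A" by blast
    then show "(ivl_deriv X ^^ i) v differentiable at x within A"
      by (rule differentiable_transform_within[OF _ zero_less_one x])
         (use assms ivl_deriv_smooth in \<open>simp add: subset_iff\<close>)
  qed
qed

text \<open>At an interior point, the limits within the open interval, within the closed interval
  and on the whole line coincide.\<close>

lemma has_deriv_ivl_deriv:
  assumes "f differentiable_on {0<..<X}" "x \<in> {0<..<X}"
  shows "(f has_real_derivative ivl_deriv X f x) (at x)"
proof -
  have "at x within {0<..<X} = at x" "at x within {0..X} = at x"
    using assms(2) by (auto intro!: at_within_interior)
  with assms show ?thesis
    unfolding ivl_deriv_def differentiable_on_def has_real_derivative_iff_has_vector_derivative
    by (metis vector_derivative_works)
qed

text \<open>The boundary bracket is an antiderivative of the integrand: upon differentiation the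
  mixed products cancel in pairs.\<close>

lemma green_identity:
  assumes "0 < X" "smooth w" "smooth s"
  shows "((\<lambda>x. (deriv ^^ 4) w x * s x - w x * (deriv ^^ 4) s x) has_integral
     (deriv ^^ 3) w X * s X - (deriv ^^ 2) w X * deriv s X
       + deriv w X * (deriv ^^ 2) s X - w X * (deriv ^^ 3) s X
     - ((deriv ^^ 3) w 0 * s 0 - (deriv ^^ 2) w 0 * deriv s 0
       + deriv w 0 * (deriv ^^ 2) s 0 - w 0 * (deriv ^^ 3) s 0)) {0..X}"
proof -
  have d: "(f has_real_derivative deriv f x) (at x)"
    "(deriv f has_real_derivative (deriv ^^ 2) f x) (at x)"
    "((deriv ^^ 2) f has_real_derivative (deriv ^^ 3) f x) (at x)"
    "((deriv ^^ 3) f has_real_derivative (deriv ^^ 4) f x) (at x)" if "smooth f" for f x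
    using smooth_has_deriv[OF that, of 0] smooth_has_deriv[OF that, of 1]
      smooth_has_deriv[OF that, of 2] smooth_has_deriv[OF that, of 3]
    by (simp_all add: eval_nat_numeral)
  note w = d[OF assms(2)] and s = d[OF assms(3)]
  have "((\<lambda>x. (deriv ^^ 3) w x * s x - (deriv ^^ 2) w x * deriv s x
       + deriv w x * (deriv ^^ 2) s x - w x * (deriv ^^ 3) s x) has_real_derivative
       (deriv ^^ 4) w x * s x - w x * (deriv ^^ 4) s x) (at x within {0..X})" for x
    by (rule has_field_derivative_at_within, rule DERIV_cong[OF DERIV_diff[OF DERIV_add[OF DERIV_diff[OF
      DERIV_mult[OF w(4) s(1)] DERIV_mult[OF w(3) s(2)]] DERIV_mult[OF w(2) s(3)]]
      DERIV_mult[OF w(1) s(4)]]]) (simp add: algebra_simps)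
  then show ?thesis
    using assms(1)
    by (intro fundamental_theorem_of_calculus)
       (auto simp flip: has_real_derivative_iff_has_vector_derivative)
qed

lemma fd_solution_cong:
  "(\<And>x. x \<in> {0<..<X} \<Longrightarrow> F x = F' x) \<Longrightarrow> fd_solution X \<mu> \<phi> F v = fd_solution X \<mu> \<phi> F' v"
  by (simp add: fd_solution_def)

section \<open>Sums of trigonometric and hyperbolic quasi-polynomials\<close>

text \<open>\<open>kX\<close> makes \<open>k\<close> a positive multiple of \<open>pi / X\<close>,
  so that \<open>k ^ 4\<close> is an eigenvalue of the unperturbed problem.\<close>

locale resonance =
  fixes X k :: real
  assumes X: "0 < X" and k: "0 < k" and kX: "sin (k * X) = 0"
begin

sublocale trig: oscillator k "-1" "\<lambda>x. cos (k * x)" "\<lambda>x. sin (k * x)"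
proof
  show "cos (k * x) * cos (k * x) - - 1 * (sin (k * x) * sin (k * x)) = 1" for x
    using sin_cos_squared_add[of "k * x"] by (simp add: power2_eq_square)
qed (use k in \<open>auto intro!: derivative_eq_intros\<close>)

sublocale hyp: oscillator k 1 "\<lambda>x. cosh (k * x)" "\<lambda>x. sinh (k * x)"
proof
  show "cosh (k * x) * cosh (k * x) - 1 * (sinh (k * x) * sinh (k * x)) = 1" for x
    using cosh_square_eq[of "k * x"] by (simp add: power2_eq_square)
qed (use k in \<open>auto intro!: derivative_eq_intros\<close>)

text \<open>The two bounds are kept separate because the hyperbolic degrees lag behind.
  \<open>h = 0\<close> means no hyperbolic part at all, whereas \<open>h = 1\<close> allows constant
  coefficients.\<close>

definition fd_space :: "nat \<Rightarrow> nat \<Rightarrow> (real \<Rightarrow> real) set" where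
  "fd_space m h = {f. \<exists>g\<in>trig.quasi m. \<exists>g'\<in>hyp.quasi h. f = (\<lambda>x. g x + g' x)}"

lemma fd_spaceI: "g \<in> trig.quasi m \<Longrightarrow> g' \<in> hyp.quasi h \<Longrightarrow> (\<lambda>x. g x + g' x) \<in> fd_space m h"
  unfolding fd_space_def by blast

lemma fd_spaceE:
  assumes "f \<in> fd_space m h"
  obtains g g' where "g \<in> trig.quasi m" "g' \<in> hyp.quasi h" "f = (\<lambda>x. g x + g' x)"
  using assms unfolding fd_space_def by blast

lemma fd_space_deriv_iter:
  assumes "f \<in> fd_space m h"
  shows "(deriv ^^ i) f \<in> fd_space m h"
proof -
  obtain g g' where *: "g \<in> trig.quasi m" "g' \<in> hyp.quasi h" "f = (\<lambda>x. g x + g' x)"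
    using assms by (elim fd_spaceE)
  have "(deriv ^^ i) f = (\<lambda>x. (deriv ^^ i) g x + (deriv ^^ i) g' x)"
    using smooth_deriv_iter_lincomb[OF trig.quasi_smooth[OF *(1)] hyp.quasi_smooth[OF *(2)], of i 1 1] *(3) by simp
  then show ?thesis
    using * by (simp only: fd_spaceI trig.quasi_deriv_iter hyp.quasi_deriv_iter)
qed

lemma fd_space_smooth:
  assumes "f \<in> fd_space m h"
  shows "smooth f"
proof -
  obtain g g' where *: "g \<in> trig.quasi m" "g' \<in> hyp.quasi h" "f = (\<lambda>x. g x + g' x)"
    using assms by (elim fd_spaceE)
  show ?thesis
    using smooth_lincomb[OF trig.quasi_smooth[OF *(1)] hyp.quasi_smooth[OF *(2)], of 1 1] *(3) by simp
qed

lemma fd_space_lincomb: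
  assumes "f \<in> fd_space m h" "g \<in> fd_space m h"
  shows "(\<lambda>x. s * f x + t * g x) \<in> fd_space m h"
proof -
  obtain f1 f2 g1 g2 where *: "f1 \<in> trig.quasi m" "f2 \<in> hyp.quasi h" "f = (\<lambda>x. f1 x + f2 x)"
    "g1 \<in> trig.quasi m" "g2 \<in> hyp.quasi h" "g = (\<lambda>x. g1 x + g2 x)"
    using assms by (elim fd_spaceE)
  then have "(\<lambda>x. s * f x + t * g x) = (\<lambda>x. (s * f1 x + t * g1 x) + (s * f2 x + t * g2 x))"
    by (simp add: algebra_simps)
  then show ?thesis
    using fd_spaceI[OF trig.quasi_lincomb[OF *(1,4)] hyp.quasi_lincomb[OF *(2,5)], of s t s t] by simp
qed

lemma fd_space_mono:
  assumes "f \<in> fd_space m h" "m \<le> m'" "h \<le> h'"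
  shows "f \<in> fd_space m' h'"
  using assms(1) trig.quasi_mono[OF assms(2)] hyp.quasi_mono[OF assms(3)]
  unfolding fd_space_def by blast

text \<open>The case distinction records that an absent hyperbolic part stays absent; a bound
  \<open>h + r\<close> throughout would lose the lag at the first step of the recursion.\<close>

lemma fd_space_mult:
  assumes "f \<in> fd_space m h" "p \<in> polys_below (Suc r)"
  shows "(\<lambda>x. poly p x * f x) \<in> fd_space (m + r) (if h = 0 then 0 else h + r)"
proof -
  obtain f1 f2 where *: "f1 \<in> trig.quasi m" "f2 \<in> hyp.quasi h" "f = (\<lambda>x. f1 x + f2 x)"
    using assms by (elim fd_spaceE)
  have "(\<lambda>x. poly p x * f2 x) \<in> hyp.quasi (if h = 0 then 0 else h + r)"
    using hyp.quasi_mult[OF *(2) assms(2)] *(2) by (auto simp: hyp.quasi_0)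
  from fd_spaceI[OF trig.quasi_mult[OF *(1) assms(2)] this] show ?thesis
    by (simp add: *(3) algebra_simps)
qed

lemma fd_space_zero: "(\<lambda>x. 0) \<in> fd_space m h"
  using fd_spaceI[OF trig.quasiI[of 0 m 0] hyp.quasiI[of 0 h 0]] by simp

lemma fd_space_sum:
  assumes "finite I" "\<And>i. i \<in> I \<Longrightarrow> f i \<in> fd_space m h"
  shows "(\<lambda>x. \<Sum>i\<in>I. c i * f i x) \<in> fd_space m h"
  using assms
proof (induction I rule: finite_induct)
  case empty
  then show ?case using fd_space_zero by simp
next
  case (insert i I)
  then show ?case
    using fd_space_lincomb[of "f i" m h "\<lambda>x. \<Sum>i\<in>I. c i * f i x" "c i" 1] by simp
qed

lemma fd_space_solvable:
  assumes "F \<in> fd_space m h"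
  obtains P where "P \<in> fd_space (Suc m) (Suc h)" "\<And>x. (deriv ^^ 4) P x = k ^ 4 * P x + F x"
proof -
  obtain f1 f2 where *: "f1 \<in> trig.quasi m" "f2 \<in> hyp.quasi h" "F = (\<lambda>x. f1 x + f2 x)"
    using assms by (elim fd_spaceE)
  obtain P1 where P1: "P1 \<in> trig.quasi (Suc m)" "\<And>x. (deriv ^^ 4) P1 x = k ^ 4 * P1 x + f1 x"
    using trig.fourth_order_solvable[OF *(1)] by blast
  obtain P2 where P2: "P2 \<in> hyp.quasi (Suc h)" "\<And>x. (deriv ^^ 4) P2 x = k ^ 4 * P2 x + f2 x"
    using hyp.fourth_order_solvable[OF *(2)] by blast
  have "(deriv ^^ 4) (\<lambda>x. P1 x + P2 x) = (\<lambda>x. (deriv ^^ 4) P1 x + (deriv ^^ 4) P2 x)"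
    using smooth_deriv_iter_lincomb[OF trig.quasi_smooth[OF P1(1)] hyp.quasi_smooth[OF P2(1)], of 4 1 1] by simp
  then show ?thesis
    using that[OF fd_spaceI[OF P1(1) P2(1)]] by (simp add: P1(2) P2(2) *(3) algebra_simps)
qed

section \<open>The homogeneous fourth-order equation\<close>

definition hom :: "real \<Rightarrow> real \<Rightarrow> real \<Rightarrow> real \<Rightarrow> real \<Rightarrow> real" where
  "hom a b c d x = a * cos (k * x) + b * sin (k * x) + c * cosh (k * x) + d * sinh (k * x)"

lemma hom_in_fd_space: "hom a b c d \<in> fd_space (Suc m) (Suc h)"
proof -
  note c = const_in_polys_below
  show ?thesis
    using fd_spaceI[OF trig.quasiI[OF c[of a m] c[of b m]] hyp.quasiI[OF c[of c h] c[of d h]]]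
    by (simp add: hom_def[abs_def] algebra_simps)
qed

lemma deriv_hom: "deriv (hom a b c d) = hom (k * b) (- k * a) (k * d) (k * c)"
  unfolding hom_def[abs_def]
  by (intro ext DERIV_imp_deriv) (auto intro!: derivative_eq_intros simp: algebra_simps)

lemma deriv2_hom: "(deriv ^^ 2) (hom a b c d) = hom (- k\<^sup>2 * a) (- k\<^sup>2 * b) (k\<^sup>2 * c) (k\<^sup>2 * d)"
  by (simp add: eval_nat_numeral deriv_hom mult.assoc)

lemma deriv4_hom: "(deriv ^^ 4) (hom a b c d) x = k ^ 4 * hom a b c d x"
  by (simp add: eval_nat_numeral deriv_hom hom_def algebra_simps)

text \<open>The combination \<open>y2 - k\<^sup>2 * y0\<close> solves the trigonometric second-order
  equation and \<open>y2 + k\<^sup>2 * y0\<close> the hyperbolic one; their difference recovers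
  \<open>y0\<close>. The derivatives are separate functions because the lemma is applied to
  differences of \<open>ivl_deriv\<close> iterates, controlled only on the open interval.\<close>

lemma homogeneous_fourth_order:
  assumes "\<And>x. x \<in> {0<..<X} \<Longrightarrow> (y0 has_real_derivative y1 x) (at x)"
    "\<And>x. x \<in> {0<..<X} \<Longrightarrow> (y1 has_real_derivative y2 x) (at x)"
    "\<And>x. x \<in> {0<..<X} \<Longrightarrow> (y2 has_real_derivative y3 x) (at x)"
    "\<And>x. x \<in> {0<..<X} \<Longrightarrow> (y3 has_real_derivative k ^ 4 * y0 x) (at x)"
  obtains a b c d where "\<And>x. x \<in> {0<..<X} \<Longrightarrow> y0 x = hom a b c d x"
proof -
  have "\<exists>A B. \<forall>x\<in>{0<..<X}. y2 x - k\<^sup>2 * y0 x = A * cos (k * x) + B * sin (k * x)"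
    by (rule trig.homogeneous_solution[where g' = "\<lambda>x. y3 x - k\<^sup>2 * y1 x"];
        rule DERIV_cong[OF DERIV_diff[OF _ DERIV_cmult]], (rule assms; assumption)+)
       (simp_all add: algebra_simps eval_nat_numeral)
  then obtain A B where 1: "\<And>x. x \<in> {0<..<X} \<Longrightarrow> y2 x - k\<^sup>2 * y0 x = A * cos (k * x) + B * sin (k * x)"
    by blast
  have "\<exists>A B. \<forall>x\<in>{0<..<X}. y2 x + k\<^sup>2 * y0 x = A * cosh (k * x) + B * sinh (k * x)"
    by (rule hyp.homogeneous_solution[where g' = "\<lambda>x. y3 x + k\<^sup>2 * y1 x"];
        rule DERIV_cong[OF DERIV_add[OF _ DERIV_cmult]], (rule assms; assumption)+)
       (simp_all add: algebra_simps eval_nat_numeral)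
  then obtain A' B' where 2: "\<And>x. x \<in> {0<..<X} \<Longrightarrow> y2 x + k\<^sup>2 * y0 x = A' * cosh (k * x) + B' * sinh (k * x)"
    by blast
  show ?thesis
  proof
    fix x assume x: "x \<in> {0<..<X}"
    have "2 * k\<^sup>2 * y0 x = A' * cosh (k * x) + B' * sinh (k * x) - (A * cos (k * x) + B * sin (k * x))"
      using 1[OF x] 2[OF x] by simp
    then show "y0 x = hom (- A / (2 * k\<^sup>2)) (- B / (2 * k\<^sup>2)) (A' / (2 * k\<^sup>2)) (B' / (2 * k\<^sup>2)) x"
      using k by (simp add: hom_def field_simps)
  qed
qed

text \<open>Stated for an arbitrary classical solution, so that it applies to whichever one
  \<open>SOME\<close> selects.\<close>

lemma fd_solution_in_fd_space:
  assumes v: "fd_solution X (k ^ 4) \<phi> F v" and F: "F \<in> fd_space m h"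
  shows "\<exists>w\<in>fd_space (Suc m) (Suc h). \<forall>x\<in>{0..X}. v x = w x"
proof -
  obtain P where P: "P \<in> fd_space (Suc m) (Suc h)" "\<And>x. (deriv ^^ 4) P x = k ^ 4 * P x + F x"
    using fd_space_solvable[OF F] by blast
  note P' = smooth_has_deriv[OF fd_space_smooth[OF P(1)]]
  define y where "y i x = (ivl_deriv X ^^ i) v x - (deriv ^^ i) P x" for i x
  have y: "(y i has_real_derivative y (Suc i) x) (at x)" if "i < 4" "x \<in> {0<..<X}" for i x
  proof -
    have "(ivl_deriv X ^^ i) v differentiable_on {0<..<X}"
      using v that by (simp add: fd_solution_def)
    from DERIV_diff[OF has_deriv_ivl_deriv[OF this that(2)] P'] show ?thesis
      by (simp add: y_def[abs_def])
  qed
  have y4: "y 4 x = k ^ 4 * y 0 x" if "x \<in> {0<..<X}" for x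
    using v that P(2)[of x] by (auto simp: fd_solution_def y_def algebra_simps)
  obtain a b c d where *: "\<And>x. x \<in> {0<..<X} \<Longrightarrow> y 0 x = hom a b c d x"
  proof (rule homogeneous_fourth_order[of "y 0" "y 1" "y 2" "y 3"])
    show "(y 3 has_real_derivative k ^ 4 * y 0 x) (at x)" if "x \<in> {0<..<X}" for x
      using y[of 3 x] y4 that by simp
  qed (use y[of 0] y[of 1] y[of 2] in \<open>simp_all add: eval_nat_numeral\<close>)
  define w where "w = (\<lambda>x. 1 * P x + 1 * hom a b c d x)"
  have w: "w \<in> fd_space (Suc m) (Suc h)"
    unfolding w_def by (rule fd_space_lincomb[OF P(1) hom_in_fd_space])
  \<comment> \<open>The case \<open>k = 0\<close> of differentiability on the closed interval gives
    continuity up to the end points.\<close>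
  have "continuous_on {0..X} v"
    using v by (auto simp: fd_solution_def intro!: differentiable_imp_continuous_on elim!: allE[of _ "0::nat"])
  moreover have "continuous_on {0..X} w"
    using smooth_continuous_on[OF fd_space_smooth[OF w], of _ 0] by simp
  ultimately have cont: "continuous_on (closure {0<..<X}) (\<lambda>x. v x - w x)"
    using X by (simp add: continuous_on_diff)
  have "v x - w x = 0" if "x \<in> {0<..<X}" for x
    using *[OF that] by (simp add: w_def y_def)
  from continuous_constant_on_closure[OF cont this] have "v x - w x = 0" if "x \<in> {0..X}" for x
    using X that by simp
  with w show ?thesis by auto
qed

section \<open>The normalized eigenfunction and existence of solutions\<close>

definition \<psi> :: "real \<Rightarrow> real" where "\<psi> x = sqrt (2 / X) * sin (k * x)"

lemma \<psi>_hom: "\<psi> = hom 0 (sqrt (2 / X)) 0 0"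
  by (simp add: fun_eq_iff \<psi>_def hom_def)

lemma \<psi>_in_fd_space: "\<psi> \<in> fd_space (Suc 0) 0"
proof -
  from fd_spaceI[OF trig.quasiI[OF zero_in_polys_below const_in_polys_below] hyp.quasiI[OF zero_in_polys_below zero_in_polys_below]]
  show ?thesis by (simp add: \<psi>_def[abs_def])
qed

lemma integral_\<psi>_square: "integral {0..X} (\<lambda>x. \<psi> x * \<psi> x) = 1"
proof -
  \<comment> \<open>The antiderivative comes from \<open>2 sin^2 = 1 - (cos^2 - sin^2)\<close>,
    where the bracket is the derivative of \<open>sin * cos\<close> up to the factor
    \<open>k\<close>. The product term vanishes at both end points, at \<open>X\<close> because of
    \<open>kX\<close>.\<close>
  have "((\<lambda>x. x / X - sin (k * x) * cos (k * x) / (k * X)) has_real_derivative \<psi> x * \<psi> x)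
      (at x within {0..X})" for x
  proof -
    have "\<psi> x * \<psi> x = (sqrt (2 / X))\<^sup>2 * (sin (k * x))\<^sup>2"
      by (simp only: \<psi>_def power2_eq_square mult_ac)
    also have "(sqrt (2 / X))\<^sup>2 = 2 / X"
      using X by (intro real_sqrt_pow2) simp
    also have "2 / X * (sin (k * x))\<^sup>2 = 1 / X - ((cos (k * x))\<^sup>2 - (sin (k * x))\<^sup>2) / X"
      by (simp add: cos_squared_eq diff_divide_distrib)
    finally have *: "\<psi> x * \<psi> x = 1 / X - ((cos (k * x))\<^sup>2 - (sin (k * x))\<^sup>2) / X" .
    have "((\<lambda>x. sin (k * x) * cos (k * x)) has_real_derivative
        k * ((cos (k * x))\<^sup>2 - (sin (k * x))\<^sup>2)) (at x)"
      by (rule DERIV_cong[OF DERIV_mult[OF trig.dS trig.dC]]) (simp add: algebra_simps power2_eq_square)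
    from DERIV_diff[OF DERIV_cdivide[OF DERIV_ident, of X x] DERIV_cdivide[OF this, of "k * X"]]
    show ?thesis
      using k by (simp add: * has_field_derivative_at_within)
  qed
  from fundamental_theorem_of_calculus[OF _ this[unfolded has_real_derivative_iff_has_vector_derivative]]
  have "((\<lambda>x. \<psi> x * \<psi> x) has_integral 1) {0..X}"
    using X kX by simp
  then show ?thesis by (rule integral_unique)
qed

lemma fd_space_integrable:
  assumes "f \<in> fd_space m h"
  shows "(\<lambda>x. f x * \<psi> x) integrable_on {0..X}"
  using smooth_continuous_on[OF fd_space_smooth[OF assms], of _ 0]
    smooth_continuous_on[OF fd_space_smooth[OF \<psi>_in_fd_space], of _ 0]
  by (intro integrable_continuous_interval continuous_on_mult) auto

lemma fd_solution_exists:
  assumes F: "F \<in> fd_space m h" and orth: "integral {0..X} (\<lambda>x. F x * \<psi> x) = 0"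
  shows "\<exists>v. fd_solution X (k ^ 4) \<psi> F v"
proof -
  obtain P where P: "P \<in> fd_space (Suc m) (Suc h)" "\<And>x. (deriv ^^ 4) P x = k ^ 4 * P x + F x"
    using fd_space_solvable[OF F] by blast
  have sinh: "sinh (k * X) \<noteq> 0"
    using X k by simp
  \<comment> \<open>\<open>a\<close> and \<open>c\<close> solve the two conditions at 0, namely
    \<open>a + c = - P 0\<close> and \<open>k^2 (c - a) = - P'' 0\<close>. Then \<open>d\<close>
    corrects the value at \<open>X\<close>, where the sine vanishes and only \<open>sinh\<close> can
    help.\<close>
  define a where "a = ((deriv ^^ 2) P 0 / k\<^sup>2 - P 0) / 2"
  define c where "c = - ((deriv ^^ 2) P 0 / k\<^sup>2 + P 0) / 2"
  define d where "d = - (P X + a * cos (k * X) + c * cosh (k * X)) / sinh (k * X)"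
  define w0 where "w0 = (\<lambda>x. 1 * P x + 1 * hom a 0 c d x)"
  \<comment> \<open>Subtracts the component along \<open>\<psi>\<close>, which has unit norm; this
    changes neither the equation nor the boundary values.\<close>
  define t where "t = - integral {0..X} (\<lambda>x. w0 x * \<psi> x)"
  define w where "w = (\<lambda>x. 1 * w0 x + t * \<psi> x)"
  have \<psi>: "\<psi> \<in> fd_space (Suc m) (Suc h)"
    by (rule fd_space_mono[OF \<psi>_in_fd_space]) auto
  have w0_in: "w0 \<in> fd_space (Suc m) (Suc h)"
    unfolding w0_def by (rule fd_space_lincomb[OF P(1) hom_in_fd_space])
  have w_in: "w \<in> fd_space (Suc m) (Suc h)"
    unfolding w_def by (rule fd_space_lincomb[OF w0_in \<psi>])
  note sm = fd_space_smooth[OF w_in] fd_space_smooth[OF \<psi>]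
  have dw0: "(deriv ^^ i) w0 x = (deriv ^^ i) P x + (deriv ^^ i) (hom a 0 c d) x" for i x
    unfolding w0_def using smooth_deriv_iter_lincomb[OF fd_space_smooth[OF P(1)] fd_space_smooth[OF hom_in_fd_space], of i 1 1]
    by simp
  have dw: "(deriv ^^ i) w x = (deriv ^^ i) w0 x + t * (deriv ^^ i) \<psi> x" for i x
    unfolding w_def using smooth_deriv_iter_lincomb[OF fd_space_smooth[OF w0_in] fd_space_smooth[OF \<psi>], of i 1 t]
    by simp
  have \<psi>0: "\<psi> 0 = 0" "\<psi> X = 0" "(deriv ^^ 2) \<psi> 0 = 0" "(deriv ^^ 2) \<psi> X = 0"
    using kX unfolding \<psi>_hom deriv2_hom by (simp_all add: hom_def)
  have ode: "(deriv ^^ 4) w x = k ^ 4 * w x + F x" for x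
    unfolding dw dw0 P(2) by (simp add: \<psi>_hom deriv4_hom w_def w0_def algebra_simps)
  have bc: "w 0 = 0" "(deriv ^^ 2) w 0 = 0" "w X = 0"
  proof -
    show "w 0 = 0"
      using \<psi>0 by (simp add: w_def w0_def hom_def a_def c_def field_simps)
    show "w X = 0"
      using \<psi>0 sinh kX by (simp add: w_def w0_def hom_def d_def)
    show "(deriv ^^ 2) w 0 = 0"
      using \<psi>0 k by (simp add: dw dw0 deriv2_hom hom_def a_def c_def field_simps)
  qed
  \<comment> \<open>Both fourth derivatives contribute the same \<open>k ^ 4\<close> term, so
    Green's identity has integral 0 on one side by \<open>orth\<close>. Among the boundary terms
    only the one with \<open>w''\<close> at \<open>X\<close> survives.\<close>
  have "(\<lambda>x. (deriv ^^ 4) w x * \<psi> x - w x * (deriv ^^ 4) \<psi> x) = (\<lambda>x. F x * \<psi> x)"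
    by (simp add: ode \<psi>_hom deriv4_hom algebra_simps)
  with integral_unique[OF green_identity[OF X sm]]
  have "(deriv ^^ 2) w X * deriv \<psi> X = 0"
    using orth bc \<psi>0 by simp
  \<comment> \<open>Since \<open>sin (k * X) = 0\<close>, the cosine there is 1 or -1.\<close>
  moreover have "deriv \<psi> X \<noteq> 0"
    using X k kX sin_zero_abs_cos_one[OF kX] by (auto simp: \<psi>_hom deriv_hom hom_def)
  ultimately have bc4: "(deriv ^^ 2) w X = 0" by simp
  have "integral {0..X} (\<lambda>x. w x * \<psi> x) = integral {0..X} (\<lambda>x. w0 x * \<psi> x + t * (\<psi> x * \<psi> x))"
    by (simp add: w_def algebra_simps)
  also have "\<dots> = integral {0..X} (\<lambda>x. w0 x * \<psi> x) + t * integral {0..X} (\<lambda>x. \<psi> x * \<psi> x)"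
    using integrable_on_mult_right[OF fd_space_integrable[OF \<psi>]]
    by (simp only: integral_add[OF fd_space_integrable[OF w0_in]] integral_mult_right)
  also have "\<dots> = 0"
    by (simp add: integral_\<psi>_square t_def)
  finally have orth': "integral {0..X} (\<lambda>x. w x * \<psi> x) = 0" .
  note ivl = ivl_deriv_smooth[OF X sm(1) refl]
  have "(ivl_deriv X ^^ 4) w x - k ^ 4 * w x = F x" if "x \<in> {0<..<X}" for x
    using ivl[of x 4] that ode[of x] by simp
  moreover have "(ivl_deriv X ^^ 2) w 0 = 0" "(ivl_deriv X ^^ 2) w X = 0"
    using ivl[of 0 2] ivl[of X 2] X bc bc4 by simp_all
  moreover have "(ivl_deriv X ^^ i) w differentiable_on {0..X}"
    "(ivl_deriv X ^^ i) w differentiable_on {0<..<X}" for i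
    by (rule ivl_deriv_smooth_differentiable[OF X sm(1) refl], force)+
  ultimately have "fd_solution X (k ^ 4) \<psi> F w"
    using bc orth' unfolding fd_solution_def by blast
  then show ?thesis by blast
qed

section \<open>Degree bounds along the recursion\<close>

lemma fd_pert_in_fd_space:
  assumes w: "w \<in> fd_space m h" "\<And>x. x \<in> {0..X} \<Longrightarrow> v x = w x"
    and p: "p0 \<in> polys_below (Suc r)" "p1 \<in> polys_below (Suc r)" "p2 \<in> polys_below (Suc r)"
  shows "\<exists>g\<in>fd_space (m + r) (if h = 0 then 0 else h + r).
    \<forall>x\<in>{0..X}. fd_pert X (poly p0) (poly p1) (poly p2) v x = g x"
proof
  let ?g = "\<lambda>x. 1 * (1 * (poly p2 x * (deriv ^^ 2) w x) + 1 * (poly p1 x * (deriv ^^ 1) w x))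
    + 1 * (poly p0 x * w x)"
  show "?g \<in> fd_space (m + r) (if h = 0 then 0 else h + r)"
    by (intro fd_space_lincomb fd_space_mult fd_space_deriv_iter w p)
  show "\<forall>x\<in>{0..X}. fd_pert X (poly p0) (poly p1) (poly p2) v x = ?g x"
    using ivl_deriv_smooth[OF X fd_space_smooth[OF w(1)] w(2), of _ 2]
      ivl_deriv_smooth[OF X fd_space_smooth[OF w(1)] w(2), of _ 1] w(2)
    by (simp add: fd_pert_def)
qed

text \<open>One step of the recursion. By \<open>orth\<close>, integrating the right-hand side
  against \<open>\<psi>\<close> keeps only the summand \<open>p = 0\<close>, whose value
  \<open>\<Lambda> (Suc j)\<close> cancels the perturbation integral; this is the solvability
  condition.\<close>

lemma fd_u_Suc_in_fd_space:
  fixes q0 q1 q2 :: "real \<Rightarrow> real" and n j :: nat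
  defines "u \<equiv> fd_u X q0 q1 q2 n" and "\<Lambda> \<equiv> fd_lambda X q0 q1 q2 n"
  assumes n: "k = real n * pi / X"
    and w: "\<And>p. p \<le> j \<Longrightarrow> w p \<in> fd_space m h"
    and uw: "\<And>p x. p \<le> j \<Longrightarrow> x \<in> {0..X} \<Longrightarrow> u p x = w p x"
    and orth: "\<And>p. p \<le> j \<Longrightarrow> integral {0..X} (\<lambda>x. u p x * \<psi> x) = (if p = 0 then 1 else 0)"
    and g: "g \<in> fd_space m h" "\<And>x. x \<in> {0..X} \<Longrightarrow> fd_pert X q0 q1 q2 (u j) x = g x"
  shows "\<exists>f\<in>fd_space (Suc m) (Suc h). \<forall>x\<in>{0..X}. u (Suc j) x = f x"
    and "integral {0..X} (\<lambda>x. u (Suc j) x * \<psi> x) = 0"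
proof -
  have u0: "u 0 = \<psi>" and \<Lambda>0: "\<Lambda> 0 = k ^ 4"
    unfolding u_def \<Lambda>_def \<psi>_def[abs_def] fd_u.simps fd_lambda.simps
      n[symmetric] power_divide[symmetric] by (rule refl)+
  \<comment> \<open>Uses the representatives \<open>w p\<close> and \<open>g\<close>, since
    membership in \<open>fd_space\<close> concerns values on the whole line. The factors 1 and -1
    match the form of \<open>fd_space_lincomb\<close>.\<close>
  define F where "F = (\<lambda>x. 1 * (\<Sum>p\<in>{0..j}. \<Lambda> (j + 1 - p) * w p x) + (-1) * g x)"
  have F: "F \<in> fd_space m h"
    unfolding F_def by (intro fd_space_lincomb fd_space_sum g) (auto intro: w)
  have \<Lambda>: "\<Lambda> (Suc j) = integral {0..X} (\<lambda>x. g x * \<psi> x)"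
  proof -
    have "\<Lambda> (Suc j) = integral {0..X} (\<lambda>x. fd_pert X q0 q1 q2 (u j) x * \<psi> x)"
      by (simp add: \<Lambda>_def u_def flip: u0)
    also have "\<dots> = integral {0..X} (\<lambda>x. g x * \<psi> x)"
      by (intro integral_cong) (simp add: g)
    finally show ?thesis .
  qed
  have wi: "((\<lambda>x. w p x * \<psi> x) has_integral (if p = 0 then 1 else 0)) {0..X}" if "p \<le> j" for p
  proof -
    have "integral {0..X} (\<lambda>x. w p x * \<psi> x) = integral {0..X} (\<lambda>x. u p x * \<psi> x)"
      by (intro integral_cong) (simp add: uw that)
    with fd_space_integrable[OF w[OF that]] orth[OF that] show ?thesis
      by (simp add: has_integral_iff)
  qed
  have gi: "((\<lambda>x. g x * \<psi> x) has_integral \<Lambda> (Suc j)) {0..X}"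
    using fd_space_integrable[OF g(1)] \<Lambda> by (simp add: has_integral_iff)
  have "((\<lambda>x. (\<Sum>p\<in>{0..j}. \<Lambda> (j + 1 - p) * (w p x * \<psi> x)) - g x * \<psi> x) has_integral
      (\<Sum>p\<in>{0..j}. \<Lambda> (j + 1 - p) * (if p = 0 then 1 else 0)) - \<Lambda> (Suc j)) {0..X}"
    by (intro has_integral_diff has_integral_sum has_integral_mult_right gi wi) auto
  also have "(\<Sum>p\<in>{0..j}. \<Lambda> (j + 1 - p) * (if p = 0 then 1 else 0)) - \<Lambda> (Suc j) = 0"
    by (simp add: sum.remove[of _ 0] if_distrib cong: if_cong)
  also have "(\<lambda>x. (\<Sum>p\<in>{0..j}. \<Lambda> (j + 1 - p) * (w p x * \<psi> x)) - g x * \<psi> x) = (\<lambda>x. F x * \<psi> x)"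
    by (simp add: F_def left_diff_distrib sum_distrib_right mult.assoc)
  finally have "integral {0..X} (\<lambda>x. F x * \<psi> x) = 0"
    by (rule integral_unique)
  then have ex: "\<exists>v. fd_solution X (k ^ 4) \<psi> F v"
    by (rule fd_solution_exists[OF F])
  \<comment> \<open>\<open>F'\<close> is the right-hand side as it occurs in the definition. It
    agrees with \<open>F\<close> on the interval, so both give the same solution predicate and the
    same choice by \<open>SOME\<close>.\<close>
  define F' where "F' = (\<lambda>x. (\<Sum>p\<in>{0..j}. \<Lambda> (j + 1 - p) * u p x) - fd_pert X q0 q1 q2 (u j) x)"
  have "fd_solution X (k ^ 4) \<psi> F' = fd_solution X (k ^ 4) \<psi> F"
    by (intro ext fd_solution_cong) (auto simp: F'_def F_def uw g intro!: sum.cong)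
  moreover have "u (Suc j) = (SOME v. fd_solution X (k ^ 4) \<psi> F' v)"
    unfolding u0[symmetric] \<Lambda>0[symmetric] F'_def unfolding u_def \<Lambda>_def by (simp only: fd_u.simps(2))
  ultimately have v: "fd_solution X (k ^ 4) \<psi> F (u (Suc j))"
    using someI_ex[OF ex] by simp
  show "\<exists>f\<in>fd_space (Suc m) (Suc h). \<forall>x\<in>{0..X}. u (Suc j) x = f x"
    by (rule fd_solution_in_fd_space[OF v F])
  show "integral {0..X} (\<lambda>x. u (Suc j) x * \<psi> x) = 0"
    using v by (simp add: fd_solution_def)
qed

text \<open>Strong induction, as the right-hand side involves all earlier corrections. The integrals
  against \<open>\<psi>\<close> are carried along because they guarantee solvability at the next
  step.\<close>

lemma fd_u_in_fd_space:
  fixes p0 p1 p2 :: "real poly" and n j :: nat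
  defines "u \<equiv> fd_u X (poly p0) (poly p1) (poly p2) n"
  assumes n: "k = real n * pi / X"
    and p: "p0 \<in> polys_below (Suc r)" "p1 \<in> polys_below (Suc r)" "p2 \<in> polys_below (Suc r)"
  shows "(\<exists>w\<in>fd_space (Suc (j * (r + 1))) (if j = 0 then 0 else Suc ((j - 1) * (r + 1))).
      \<forall>x\<in>{0..X}. u j x = w x) \<and>
    integral {0..X} (\<lambda>x. u j x * \<psi> x) = (if j = 0 then 1 else 0)"
proof (induction j rule: less_induct)
  case (less i)
  define H where "H j = (if j = 0 then 0 else Suc ((j - 1) * (r + 1)))" for j
  note IH = less.IH[folded H_def]
  show ?case
  proof (cases i)
    case 0
    have "u 0 = \<psi>"
      unfolding u_def \<psi>_def[abs_def] fd_u.simps n[symmetric] by (rule refl)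
    then show ?thesis
      using \<psi>_in_fd_space 0 by (auto simp: integral_\<psi>_square)
  next
    case (Suc j)
    obtain w where w: "\<And>p. p \<le> j \<Longrightarrow> w p \<in> fd_space (Suc (p * (r + 1))) (H p)"
      "\<And>p x. p \<le> j \<Longrightarrow> x \<in> {0..X} \<Longrightarrow> u p x = w p x"
      using IH unfolding Suc less_Suc_eq_le Bex_def by metis
    obtain g where g: "g \<in> fd_space (Suc (j * (r + 1)) + r) (if H j = 0 then 0 else H j + r)"
      "\<And>x. x \<in> {0..X} \<Longrightarrow> fd_pert X (poly p0) (poly p1) (poly p2) (u j) x = g x"
      using fd_pert_in_fd_space[OF w(1)[of j] w(2)[of j] p] by blast
    \<comment> \<open>The perturbation brings the bounds of \<open>u j\<close> to at most
      \<open>Suc j * (r + 1)\<close> and \<open>j * (r + 1)\<close>, and all earlier corrections fit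
      within these. Solving the equation adds the final \<open>Suc\<close> to both.\<close>
    have w': "w p \<in> fd_space (Suc j * (r + 1)) (j * (r + 1))" if "p \<le> j" for p
    proof (rule fd_space_mono[OF w(1)[OF that]])
      have "p * (r + 1) \<le> j * (r + 1)"
        using that by (rule mult_le_mono1)
      then show "Suc (p * (r + 1)) \<le> Suc j * (r + 1)" by simp
      show "H p \<le> j * (r + 1)"
        using \<open>p * (r + 1) \<le> j * (r + 1)\<close> by (cases p) (simp_all add: H_def)
    qed
    have g': "g \<in> fd_space (Suc j * (r + 1)) (j * (r + 1))"
      by (rule fd_space_mono[OF g(1)]) (cases j; simp add: H_def)+
    have orth: "integral {0..X} (\<lambda>x. u p x * \<psi> x) = (if p = 0 then 1 else 0)" if "p \<le> j" for p
      using IH[of p] that Suc by simp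
    show ?thesis
      using fd_u_Suc_in_fd_space[OF n w' w(2)[unfolded u_def] orth[unfolded u_def] g' g(2)[unfolded u_def]]
      unfolding Suc u_def by simp
  qed
qed

section \<open>Reading off the coefficients\<close>

lemma fd_space_coeffs:
  assumes "f \<in> fd_space (Suc m) (Suc h)"
  shows "\<exists>a b c d. \<forall>x. f x = (\<Sum>p=0..m. x ^ p * (b p * cos (k * x) + a p * sin (k * x)))
    + (\<Sum>p=0..h. x ^ p * (d p * cosh (k * x) + c p * sinh (k * x)))"
proof -
  obtain g g' where g: "g \<in> trig.quasi (Suc m)" "g' \<in> hyp.quasi (Suc h)" "f = (\<lambda>x. g x + g' x)"
    using assms by (elim fd_spaceE)
  obtain b a where ba: "b \<in> polys_below (Suc m)" "a \<in> polys_below (Suc m)"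
    "g = (\<lambda>x. poly b x * cos (k * x) + poly a x * sin (k * x))"
    using g(1) by (elim trig.quasiE)
  obtain d c where dc: "d \<in> polys_below (Suc h)" "c \<in> polys_below (Suc h)"
    "g' = (\<lambda>x. poly d x * cosh (k * x) + poly c x * sinh (k * x))"
    using g(2) by (elim hyp.quasiE)
  have *: "(\<Sum>i=0..l. x ^ i * (coeff p i * y + coeff q i * z)) =
    (\<Sum>i=0..l. coeff p i * x ^ i) * y + (\<Sum>i=0..l. coeff q i * x ^ i) * z"
    for l p q and x y z :: real
    by (simp add: sum_distrib_left distrib_left sum.distrib mult_ac)
  have "f x = (\<Sum>p=0..m. x ^ p * (coeff b p * cos (k * x) + coeff a p * sin (k * x)))
    + (\<Sum>p=0..h. x ^ p * (coeff d p * cosh (k * x) + coeff c p * sinh (k * x)))" for x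
    unfolding g(3) ba(3) dc(3) poly_eq_sum_below[OF ba(1)] poly_eq_sum_below[OF ba(2)]
      poly_eq_sum_below[OF dc(1)] poly_eq_sum_below[OF dc(2)] * by (rule refl)
  then show ?thesis by blast
qed

end

theorem lemma2:
  fixes X :: real and A B C :: "nat \<Rightarrow> real" and r0 r1 r2 r n :: nat
    and q0 q1 q2 :: "real \<Rightarrow> real" and M :: "nat \<Rightarrow> nat"
  assumes "0 < X"
    and "1 \<le> r0" and "1 \<le> r1" and "1 \<le> r2"
    and "q0 = (\<lambda>x. \<Sum>l=0..r0. A l * x ^ l)"
    and "q1 = (\<lambda>x. \<Sum>l=0..r1. B l * x ^ l)"
    and "q2 = (\<lambda>x. \<Sum>l=0..r2. C l * x ^ l)"
    and "r = Max {r0, r1, r2}"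
    and "M = (\<lambda>j. j * (r + 1))"
    and "1 \<le> n"
  shows "\<exists>a b c d :: nat \<Rightarrow> nat \<Rightarrow> real.
    a 0 0 = sqrt (2 / X) \<and> b 0 0 = 0 \<and> c 0 0 = 0 \<and> d 0 0 = 0 \<and>
    (\<forall>x\<in>{0..X}. fd_u X q0 q1 q2 n 0 x =
        b 0 0 * cos (pi * real n / X * x) + a 0 0 * sin (pi * real n / X * x)
        + d 0 0 * cosh (pi * real n / X * x) + c 0 0 * sinh (pi * real n / X * x)) \<and>
    (\<forall>j. \<forall>x\<in>{0..X}. fd_u X q0 q1 q2 n (j + 1) x =
        (\<Sum>p=0..M (j + 1). x ^ p * (b (j + 1) p * cos (pi * real n / X * x)
                                   + a (j + 1) p * sin (pi * real n / X * x)))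
        + (\<Sum>p=0..M j. x ^ p * (d (j + 1) p * cosh (pi * real n / X * x)
                               + c (j + 1) p * sinh (pi * real n / X * x))))"
proof -
  define k where "k = pi * real n / X"
  have "0 < k" "sin (k * X) = 0"
    using assms(1,10) by (simp_all add: k_def sin_npi2)
  with assms(1) interpret resonance X k
    by unfold_locales
  have n: "k = real n * pi / X"
    by (simp add: k_def mult.commute)
  have le: "r0 \<le> r" "r1 \<le> r" "r2 \<le> r"
    using assms(8) by simp_all
  obtain p0 where p0: "p0 \<in> polys_below (Suc r)" "q0 = poly p0"
    using sum_power_eq_poly[OF le(1)] assms(5) by metis
  obtain p1 where p1: "p1 \<in> polys_below (Suc r)" "q1 = poly p1"
    using sum_power_eq_poly[OF le(2)] assms(6) by metis
  obtain p2 where p2: "p2 \<in> polys_below (Suc r)" "q2 = poly p2"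
    using sum_power_eq_poly[OF le(3)] assms(7) by metis
  have "\<forall>j. \<exists>a b c d. \<forall>x\<in>{0..X}. fd_u X q0 q1 q2 n (j + 1) x =
      (\<Sum>p=0..M (j + 1). x ^ p * (b p * cos (k * x) + a p * sin (k * x)))
      + (\<Sum>p=0..M j. x ^ p * (d p * cosh (k * x) + c p * sinh (k * x)))"
  proof
    fix j
    obtain w where w: "w \<in> fd_space (Suc (M (j + 1))) (Suc (M j))"
      "\<And>x. x \<in> {0..X} \<Longrightarrow> fd_u X q0 q1 q2 n (j + 1) x = w x"
      using fd_u_in_fd_space[OF n p0(1) p1(1) p2(1), of "Suc j"]
      unfolding p0(2) p1(2) p2(2) assms(9) by auto
    show "\<exists>a b c d. \<forall>x\<in>{0..X}. fd_u X q0 q1 q2 n (j + 1) x =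
      (\<Sum>p=0..M (j + 1). x ^ p * (b p * cos (k * x) + a p * sin (k * x)))
      + (\<Sum>p=0..M j. x ^ p * (d p * cosh (k * x) + c p * sinh (k * x)))"
      using fd_space_coeffs[OF w(1)] by (elim exE) (intro exI ballI, simp only: w(2))
  qed
  then obtain a b c d where abcd: "\<And>j x. x \<in> {0..X} \<Longrightarrow> fd_u X q0 q1 q2 n (j + 1) x =
      (\<Sum>p=0..M (j + 1). x ^ p * (b j p * cos (k * x) + a j p * sin (k * x)))
      + (\<Sum>p=0..M j. x ^ p * (d j p * cosh (k * x) + c j p * sinh (k * x)))"
    unfolding choice_iff by blast
  have 0: "fd_u X q0 q1 q2 n 0 x = sqrt (2 / X) * sin (k * x)" for x
    by (simp add: n mult_ac)
  show ?thesis
    unfolding k_def[symmetric]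
    \<comment> \<open>The chosen \<open>a j\<close>, \<open>b j\<close>, \<open>c j\<close>,
      \<open>d j\<close> belong to correction \<open>j + 1\<close>; \<open>case_nat\<close> shifts
      the index and puts the initial coefficients at 0.\<close>
    by (intro exI[of _ "case_nat (\<lambda>_. sqrt (2 / X)) a"] exI[of _ "case_nat (\<lambda>_. 0) b"]
        exI[of _ "case_nat (\<lambda>_. 0) c"] exI[of _ "case_nat (\<lambda>_. 0) d"])
      (use 0 abcd in \<open>simp del: fd_u.simps\<close>)
qed

end
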